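(* Let $\mathcal{F}$ be a projective system in $\mathbf{PreSpec}$, given by a directed partially ordered set $I$, pre-spectral spaces $(X_i)_{i\in I}$ and spectral bonding maps $f_{i,j}\colon X_i\to X_j$ for $i\geq j$. If $\{f_i\colon X\to X_i\}_{i\in I}$ is the limit of $\mathcal{F}$ in the category $\mathbf{Top}$ of topological spaces and continuous maps, and all the maps $f_i\colon X\to X_i$ are spectral, then it is the limit of $\mathcal{F}$ in $\mathbf{PreSpec}$. Moreover, $\mathcal{K}^\circ(X)=\bigcup_{i\in I}\{f_i^{-1}(V)\mid V\in\mathcal{K}^\circ(X_i)\}$.
   Context: "Compact" means every open cover has a finite subcover (no separation axiom). For a topological space $X$, $\mathcal{K}^\circ(X)$ is the set of compact open subsets of $X$. $X$ is pre-spectral if $\mathcal{K}^\circ(X)$ is a sublattice of $\wp(X)$ containing $\emptyset$ and $X$ and generating the topology of $X$. A map between topological spaces is spectral if it is continuous and preimages of compact open sets are compact open. $\mathbf{PreSpec}$ is the category of pre-spectral spaces and spectral maps. A projective system in a category assigns to each element $i$ of a (non-empty) directed partially ordered set $I$ an object $X_i$ and to each pair $i\geq j$ a morphism $f_{i,j}\colon X_i\to X_j$ such that $f_{i,i}=\mathrm{id}$ and $f_{j,k}\circ f_{i,j}=f_{i,k}$ for $k\leq j\leq i$. Its limit is an object $X$ with morphisms $f_i\colon X\to X_i$ that are compatible ($f_{i,j}\circ f_i=f_j$ for $i\geq j$) and universal: for every compatible family $g_i\colon Y\to X_i$ there is a unique morphism $g\colon Y\to X$ with $g_i=f_i\circ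 g$ for all $i$. *)

theory Defs
  imports "HOL-Analysis.Analysis"
begin

definition compact_opens :: "'a topology \<Rightarrow> 'a set set" where
  "compact_opens X = {U. openin X U \<and> compactin X U}"

definition pre_spectral :: "'a topology \<Rightarrow> bool" where
  "pre_spectral X \<longleftrightarrow>
     {} \<in> compact_opens X \<and> topspace X \<in> compact_opens X \<and>
     (\<forall>U\<in>compact_opens X. \<forall>V\<in>compact_opens X.
        U \<union> V \<in> compact_opens X \<and> U \<inter> V \<in> compact_opens X) \<and>
     X = topology_generated_by (compact_opens X)"

definition spectral_map :: "'a topology \<Rightarrow> 'b topology \<Rightarrow> ('a \<Rightarrow> 'b) \<Rightarrow> bool" where
  "spectral_map X Y f \<longleftrightarrow>
     continuous_map X Y f \<and>
     (\<forall>V\<in>compact_opens Y. {x \<in> topspace X. f x \<in> V} \<in> compact_opens X)"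

text \<open>
  In an index relation \<open>r\<close>, \<open>(j, i) \<in> r\<close> means \<open>j \<le> i\<close>; the bonding map
  \<open>f i j\<close> goes from \<open>X i\<close> to \<open>X j\<close> and is constrained for \<open>j \<le> i\<close> only.
\<close>

definition directed_poset :: "'i set \<Rightarrow> 'i rel \<Rightarrow> bool" where
  "directed_poset I r \<longleftrightarrow>
     I \<noteq> {} \<and> partial_order_on I r \<and>
     (\<forall>i\<in>I. \<forall>j\<in>I. \<exists>k\<in>I. (i, k) \<in> r \<and> (j, k) \<in> r)"

definition projective_system_PreSpec ::
  "'i set \<Rightarrow> 'i rel \<Rightarrow> ('i \<Rightarrow> 'a topology) \<Rightarrow> ('i \<Rightarrow> 'i \<Rightarrow> 'a \<Rightarrow> 'a) \<Rightarrow> bool" where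
  "projective_system_PreSpec I r X f \<longleftrightarrow>
     directed_poset I r \<and>
     (\<forall>i\<in>I. pre_spectral (X i)) \<and>
     (\<forall>i j. (j, i) \<in> r \<longrightarrow> spectral_map (X i) (X j) (f i j)) \<and>
     (\<forall>i\<in>I. \<forall>x\<in>topspace (X i). f i i x = x) \<and>
     (\<forall>i j k. (k, j) \<in> r \<and> (j, i) \<in> r \<longrightarrow>
        (\<forall>x\<in>topspace (X i). f j k (f i j x) = f i k x))"

definition compatible_maps ::
  "'i rel \<Rightarrow> ('i \<Rightarrow> 'i \<Rightarrow> 'a \<Rightarrow> 'a) \<Rightarrow> 'y topology \<Rightarrow> ('i \<Rightarrow> 'y \<Rightarrow> 'a) \<Rightarrow> bool" where
  "compatible_maps r f Y g \<longleftrightarrow>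
     (\<forall>i j. (j, i) \<in> r \<longrightarrow> (\<forall>y\<in>topspace Y. f i j (g i y) = g j y))"

text \<open>
  The two limit predicates say that \<open>L\<close>, with the projections \<open>p i\<close>, is a limit
  cone in the category of topological spaces and in that of pre-spectral spaces.
  HOL cannot quantify over types inside a formula, so the first argument names the
  type \<open>'y\<close> over which the points of the test objects \<open>Y\<close> range. Since maps on
  \<open>topspace Y\<close> are represented by total functions, the mediating map is normalised
  outside \<open>topspace Y\<close> by \<^const>\<open>extensional\<close>; otherwise it could not be unique.
\<close>

definition is_limit_Top ::
  "'y itself \<Rightarrow> 'i set \<Rightarrow> 'i rel \<Rightarrow> ('i \<Rightarrow> 'a topology) \<Rightarrow> ('i \<Rightarrow> 'i \<Rightarrow> 'a \<Rightarrow> 'a) \<Rightarrow>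
   'x topology \<Rightarrow> ('i \<Rightarrow> 'x \<Rightarrow> 'a) \<Rightarrow> bool" where
  "is_limit_Top _ I r X f L p \<longleftrightarrow>
     (\<forall>i\<in>I. continuous_map L (X i) (p i)) \<and> compatible_maps r f L p \<and>
     (\<forall>(Y :: 'y topology) g.
        (\<forall>i\<in>I. continuous_map Y (X i) (g i)) \<and> compatible_maps r f Y g \<longrightarrow>
        (\<exists>!h. h \<in> extensional (topspace Y) \<and> continuous_map Y L h \<and>
              (\<forall>i\<in>I. \<forall>y\<in>topspace Y. g i y = p i (h y))))"

definition is_limit_PreSpec ::
  "'y itself \<Rightarrow> 'i set \<Rightarrow> 'i rel \<Rightarrow> ('i \<Rightarrow> 'a topology) \<Rightarrow> ('i \<Rightarrow> 'i \<Rightarrow> 'a \<Rightarrow> 'a) \<Rightarrow>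
   'x topology \<Rightarrow> ('i \<Rightarrow> 'x \<Rightarrow> 'a) \<Rightarrow> bool" where
  "is_limit_PreSpec _ I r X f L p \<longleftrightarrow>
     pre_spectral L \<and>
     (\<forall>i\<in>I. spectral_map L (X i) (p i)) \<and> compatible_maps r f L p \<and>
     (\<forall>(Y :: 'y topology) g. pre_spectral Y \<and>
        (\<forall>i\<in>I. spectral_map Y (X i) (g i)) \<and> compatible_maps r f Y g \<longrightarrow>
        (\<exists>!h. h \<in> extensional (topspace Y) \<and> spectral_map Y L h \<and>
              (\<forall>i\<in>I. \<forall>y\<in>topspace Y. g i y = p i (h y))))"

text \<open>
  For topological spaces, test objects on the point type of \<open>L\<close> itself suffice:
  one-point test spaces determine the points of \<open>L\<close>, and \<open>topspace L\<close> with the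
  initial topology of the \<open>p i\<close> determines its topology. Hence assuming
  \<open>is_limit_Top TYPE('x) I r X f L p\<close> amounts to the universal property against
  test objects of every type.
\<close>

lemma is_limit_Top_any_type:
  fixes L :: "'x topology"
  assumes lim: "is_limit_Top TYPE('x) I r X f L p"
  shows "is_limit_Top TYPE('y) I r X f L p"
proof -
  have cont: "\<And>i. i \<in> I \<Longrightarrow> continuous_map L (X i) (p i)"
    and comp: "compatible_maps r f L p"
    using lim by (auto simp: is_limit_Top_def)
  have univ: "\<exists>!h. h \<in> extensional (topspace Y) \<and> continuous_map Y L h \<and>
        (\<forall>i\<in>I. \<forall>y\<in>topspace Y. g i y = p i (h y))"
    if "\<And>i. i \<in> I \<Longrightarrow> continuous_map Y (X i) (g i)" "compatible_maps r f Y g"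
    for Y :: "'x topology" and g
    using lim that unfolding is_limit_Top_def by blast
  have pt: "\<exists>!x. x \<in> topspace L \<and> (\<forall>i\<in>I. p i x = c i)"
    if c: "\<And>i. i \<in> I \<Longrightarrow> c i \<in> topspace (X i)"
      and cc: "\<And>i j. (j, i) \<in> r \<Longrightarrow> f i j (c i) = c j" for c
  proof -
    define D where "D = discrete_topology {undefined :: 'x}"
    have D: "topspace D = {undefined}" by (simp add: D_def)
    have *: "\<exists>!h. h \<in> extensional (topspace D) \<and> continuous_map D L h \<and>
        (\<forall>i\<in>I. \<forall>y\<in>topspace D. c i = p i (h y))"
      using univ[of D "\<lambda>i _. c i"] c cc by (auto simp: compatible_maps_def)
    then obtain h where "continuous_map D L h" "\<forall>i\<in>I. c i = p i (h undefined)"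
      by (auto simp: D)
    then have h: "h undefined \<in> topspace L" "\<forall>i\<in>I. p i (h undefined) = c i"
      by (auto simp: continuous_map_def D)
    have "x = y" if "x \<in> topspace L" "\<forall>i\<in>I. p i x = c i"
        "y \<in> topspace L" "\<forall>i\<in>I. p i y = c i" for x y
    proof -
      have "restrict (\<lambda>_. z) {undefined} \<in> extensional (topspace D) \<and>
          continuous_map D L (restrict (\<lambda>_. z) {undefined}) \<and>
          (\<forall>i\<in>I. \<forall>y\<in>topspace D. c i = p i (restrict (\<lambda>_. z) {undefined} y))"
        if "z \<in> topspace L" "\<forall>i\<in>I. p i z = c i" for z
        using that by (auto simp: D D_def)
      then have "restrict (\<lambda>_. x) {undefined :: 'x} = restrict (\<lambda>_. y) {undefined}"
        using * that by blast
      then show ?thesis by (metis restrict_apply singletonI)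
    qed
    with h show ?thesis by blast
  qed
  have eqI: "x = y" if "x \<in> topspace L" "y \<in> topspace L" "\<And>i. i \<in> I \<Longrightarrow> p i x = p i y" for x y
  proof -
    have "p i x \<in> topspace (X i)" if "i \<in> I" for i
      using cont[OF that] \<open>x \<in> topspace L\<close> by (auto simp: continuous_map_def)
    moreover have "f i j (p i x) = p j x" if "(j, i) \<in> r" for i j
      using comp that \<open>x \<in> topspace L\<close> by (auto simp: compatible_maps_def)
    ultimately show ?thesis using pt[of "\<lambda>i. p i x"] that by metis
  qed
  define S where "S = insert (topspace L)
     {{x \<in> topspace L. p i x \<in> V} | i V. i \<in> I \<and> openin (X i) V}"
  define T where "T = topology_generated_by S"
  have topT: "topspace T = topspace L"
    by (auto simp: T_def S_def)
  have "continuous_map T (X i) (p i)" if "i \<in> I" for i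
    unfolding continuous_map topT
  proof (intro conjI allI impI)
    show "p i ` topspace L \<subseteq> topspace (X i)"
      using cont[OF that] by (auto simp: continuous_map_def)
    fix V assume "openin (X i) V"
    then show "openin T {x \<in> topspace L. p i x \<in> V}"
      unfolding T_def using that by (intro topology_generated_by_Basis) (auto simp: S_def)
  qed
  moreover have "compatible_maps r f T p"
    using comp by (simp add: compatible_maps_def topT)
  ultimately obtain k where k: "continuous_map T L k"
      and kp: "\<forall>i\<in>I. \<forall>x\<in>topspace L. p i x = p i (k x)"
    using univ[of T p] unfolding topT by blast
  have k_id: "k x = x" if "x \<in> topspace L" for x
    using eqI[of "k x" x] k kp that by (auto simp: continuous_map_def topT)
  have idc: "continuous_map T L id"
    using continuous_map_eq[OF k, of id] by (simp add: k_id topT)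
  have LT: "continuous_map Y L h" if "continuous_map Y T h" for Y :: "'y topology" and h
    using continuous_map_compose[OF that idc] by simp
  have "\<exists>!h. h \<in> extensional (topspace Y) \<and> continuous_map Y L h \<and>
        (\<forall>i\<in>I. \<forall>y\<in>topspace Y. g i y = p i (h y))"
    if g: "\<And>i. i \<in> I \<Longrightarrow> continuous_map Y (X i) (g i)" and gc: "compatible_maps r f Y g"
    for Y :: "'y topology" and g
  proof -
    have "\<exists>x. x \<in> topspace L \<and> (\<forall>i\<in>I. p i x = g i y)" if "y \<in> topspace Y" for y
    proof -
      have "g i y \<in> topspace (X i)" if "i \<in> I" for i
        using g[OF that] \<open>y \<in> topspace Y\<close> by (auto simp: continuous_map_def)
      moreover have "f i j (g i y) = g j y" if "(j, i) \<in> r" for i j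
        using gc that \<open>y \<in> topspace Y\<close> by (auto simp: compatible_maps_def)
      ultimately show ?thesis using pt[of "\<lambda>i. g i y"] by blast
    qed
    then obtain h0 where h0: "\<And>y. y \<in> topspace Y \<Longrightarrow> h0 y \<in> topspace L"
        "\<And>y i. y \<in> topspace Y \<Longrightarrow> i \<in> I \<Longrightarrow> p i (h0 y) = g i y"
      by metis
    define h where "h = restrict h0 (topspace Y)"
    have h: "\<And>y. y \<in> topspace Y \<Longrightarrow> h y \<in> topspace L"
        "\<And>y i. y \<in> topspace Y \<Longrightarrow> i \<in> I \<Longrightarrow> p i (h y) = g i y"
      using h0 by (auto simp: h_def)
    have "continuous_map Y T h"
      unfolding T_def
    proof (rule continuous_on_generated_topo)
      show "h ` topspace Y \<subseteq> \<Union> S" using h by (auto simp: S_def)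
      fix U assume "U \<in> S"
      then consider "U = topspace L"
        | i V where "i \<in> I" "openin (X i) V" "U = {x \<in> topspace L. p i x \<in> V}"
        by (auto simp: S_def)
      then show "openin Y (h -` U \<inter> topspace Y)"
      proof cases
        case 1
        then have "h -` U \<inter> topspace Y = topspace Y" using h by auto
        then show ?thesis by simp
      next
        case 2
        then have "h -` U \<inter> topspace Y = {y \<in> topspace Y. g i y \<in> V}" using h by auto
        then show ?thesis using g[OF 2(1)] 2(2) by (simp add: continuous_map_def)
      qed
    qed
    then have "continuous_map Y L h" by (rule LT)
    moreover have "h \<in> extensional (topspace Y)" by (simp add: h_def)
    moreover have "h' = h" if "h' \<in> extensional (topspace Y)" "continuous_map Y L h'"
        "\<forall>i\<in>I. \<forall>y\<in>topspace Y. g i y = p i (h' y)" for h'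
    proof (rule extensionalityI[OF that(1)])
      show "h \<in> extensional (topspace Y)" by (simp add: h_def)
      fix y assume y: "y \<in> topspace Y"
      then have "h' y \<in> topspace L" using that(2) by (auto simp: continuous_map_def)
      then show "h' y = h y" using eqI[of "h' y" "h y"] h y that(3) by auto
    qed
    moreover have "\<forall>i\<in>I. \<forall>y\<in>topspace Y. g i y = p i (h y)" using h(2) by simp
    ultimately show ?thesis by (intro ex1I[of _ h]) blast+
  qed
  then show ?thesis
    unfolding is_limit_Top_def using cont comp by (intro conjI allI impI ballI) simp_all
qed

end

theory Submission
  imports Defs
begin

text \<open>
  A limit in the category of topological spaces carries the initial topology of its
  projections, which is generated by the preimages of the compact open sets of the
  \<open>X i\<close>. As the index set is directed and the bonding maps are spectral, these
  preimages form a lattice of sets, so they are a basis; they are compact because the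
  projections are spectral, and a compact open set, being a finite union of basic sets, is
  itself basic.
\<close>

text \<open>A subbasis closed under binary intersections is already a basis. Induction on the
  generation of \<open>U\<close> proves this for all points of \<open>U\<close> at once: the
  intersection case is the only one that needs \<open>Int\<close>, and unions inherit the
  neighbourhood from one of their members.\<close>

lemma openin_generated_by_Int_closed:
  assumes "openin (topology_generated_by B) U" "x \<in> U"
    and Int: "\<And>V W. V \<in> B \<Longrightarrow> W \<in> B \<Longrightarrow> V \<inter> W \<in> B"
  obtains W where "W \<in> B" "x \<in> W" "W \<subseteq> U"
proof -
  have "generate_topology_on B U"
    using assms(1) by (simp add: openin_topology_generated_by_iff)
  then have "\<forall>x\<in>U. \<exists>W\<in>B. x \<in> W \<and> W \<subseteq> U"
  proof induction
    case (Int U V)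
    show ?case
    proof
      fix x assume "x \<in> U \<inter> V"
      then obtain W W' where "W \<in> B" "x \<in> W" "W \<subseteq> U" "W' \<in> B" "x \<in> W'" "W' \<subseteq> V"
        using Int.IH by blast
      then show "\<exists>W\<in>B. x \<in> W \<and> W \<subseteq> U \<inter> V"
        by (intro bexI[of _ "W \<inter> W'"] assms(3)) auto
    qed
  next
    case (UN K)
    then show ?case by (meson Union_iff Union_upper subset_trans)
  qed auto
  then show thesis using that assms(2) by blast
qed

text \<open>A compact open set is the union of the members of \<open>B\<close> inside it, hence of
  finitely many of them. That finite union lies in \<open>B\<close> by \<open>Un\<close>, with
  \<open>empty\<close> covering the case of the empty subfamily.\<close>

lemma compact_opens_generated_by_lattice:
  assumes gen: "X = topology_generated_by B" and sub: "B \<subseteq> compact_opens X"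
    and empty: "{} \<in> B"
    and Un: "\<And>V W. V \<in> B \<Longrightarrow> W \<in> B \<Longrightarrow> V \<union> W \<in> B"
    and Int: "\<And>V W. V \<in> B \<Longrightarrow> W \<in> B \<Longrightarrow> V \<inter> W \<in> B"
  shows "compact_opens X = B"
proof
  show "compact_opens X \<subseteq> B"
  proof
    fix U assume "U \<in> compact_opens X"
    then have op: "openin X U" and co: "compactin X U"
      by (auto simp: compact_opens_def)
    have "U \<subseteq> \<Union>{W \<in> B. W \<subseteq> U}"
    proof
      fix x assume "x \<in> U"
      then obtain W where "W \<in> B" "x \<in> W" "W \<subseteq> U"
        using openin_generated_by_Int_closed[OF op[unfolded gen] _ Int] by blast
      then show "x \<in> \<Union>{W \<in> B. W \<subseteq> U}" by blast
    qed
    moreover have "\<forall>W\<in>{W \<in> B. W \<subseteq> U}. openin X W"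
      using sub by (auto simp: compact_opens_def)
    ultimately obtain F where F: "finite F" "F \<subseteq> {W \<in> B. W \<subseteq> U}" "U \<subseteq> \<Union>F"
      using compactinD[OF co, of "{W \<in> B. W \<subseteq> U}"] by blast
    have "F \<subseteq> B" using F(2) by blast
    with F(1) have "\<Union>F \<in> B"
      by induction (auto simp: empty Un)
    moreover have "U = \<Union>F" using F(2,3) by blast
    ultimately show "U \<in> B" by simp
  qed
qed (fact sub)

text \<open>The points of \<open>L\<close> with the generated topology form a space \<open>T\<close>
  that still maps continuously to every \<open>X i\<close>. Taking \<open>T\<close> itself as test
  object yields a map back to \<open>L\<close>, which uniqueness forces to be the identity on
  points. Allowing any subbases \<open>S i\<close> makes the result applicable to the compact open
  sets.\<close>

lemma is_limit_Top_generated_by: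
  fixes L :: "'x topology"
  assumes lim: "is_limit_Top TYPE('x) I r X f L p" and "I \<noteq> {}"
    and gen: "\<And>i. i \<in> I \<Longrightarrow> X i = topology_generated_by (S i)"
  shows "L = topology_generated_by (\<Union>i\<in>I. {{x \<in> topspace L. p i x \<in> V} | V. V \<in> S i})"
    (is "L = topology_generated_by ?B")
proof -
  define T where "T = topology_generated_by ?B"
  have cont: "\<And>i. i \<in> I \<Longrightarrow> continuous_map L (X i) (p i)"
    and comp: "compatible_maps r f L p"
    using lim by (auto simp: is_limit_Top_def)
  have univ: "\<exists>!h. h \<in> extensional (topspace Y) \<and> continuous_map Y L h \<and>
        (\<forall>i\<in>I. \<forall>y\<in>topspace Y. g i y = p i (h y))"
    if "\<And>i. i \<in> I \<Longrightarrow> continuous_map Y (X i) (g i)" "compatible_maps r f Y g"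
    for Y :: "'x topology" and g
    using lim that unfolding is_limit_Top_def by blast
  have p_in: "p i x \<in> \<Union>(S i)" if "i \<in> I" "x \<in> topspace L" for i x
    using cont[OF that(1)] that gen[OF that(1)]
    by (metis continuous_map_image_subset_topspace image_subset_iff topology_generated_by_topspace)
  \<comment> \<open>The points of a generated topology are the union of its generators, so
    \<open>T\<close> has all points of \<open>L\<close> only if the preimages cover; one index
    suffices, since \<open>S i\<close> covers \<open>X i\<close>.\<close>
  have "topspace L \<subseteq> \<Union>?B"
  proof
    fix x assume x: "x \<in> topspace L"
    obtain i where i: "i \<in> I" using \<open>I \<noteq> {}\<close> by blast
    then obtain V where "V \<in> S i" "p i x \<in> V" using p_in x by blast
    with i x show "x \<in> \<Union>?B" by blast
  qed
  then have topT: "topspace T = topspace L"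
    unfolding T_def topology_generated_by_topspace by blast
  have B_open: "openin L U" if "U \<in> ?B" for U
  proof -
    from that obtain i V where iV: "i \<in> I" "V \<in> S i" "U = {x \<in> topspace L. p i x \<in> V}"
      by blast
    then have "openin (X i) V" using gen topology_generated_by_Basis by metis
    then show ?thesis using cont[OF iV(1)] iV(3) by (simp add: continuous_map_def)
  qed
  have LT: "continuous_map L T id"
    unfolding T_def
  proof (rule continuous_on_generated_topo)
    show "openin L (id -` U \<inter> topspace L)" if "U \<in> ?B" for U
      using B_open[OF that] by (simp add: openin_Int)
    show "id ` topspace L \<subseteq> \<Union>?B"
      using topT by (simp add: T_def)
  qed
  have "continuous_map T (X i) (p i)" if i: "i \<in> I" for i
    unfolding gen[OF i]
  proof (rule continuous_on_generated_topo)
    show "p i ` topspace T \<subseteq> \<Union>(S i)" using p_in[OF i] by (auto simp: topT)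
    fix V assume "V \<in> S i"
    moreover have "p i -` V \<inter> topspace T = {x \<in> topspace L. p i x \<in> V}" by (auto simp: topT)
    ultimately show "openin T (p i -` V \<inter> topspace T)"
      unfolding T_def using i by (auto intro!: topology_generated_by_Basis)
  qed
  moreover have "compatible_maps r f T p"
    using comp by (simp add: compatible_maps_def topT)
  ultimately obtain k where k: "k \<in> extensional (topspace L)" "continuous_map T L k"
      "\<forall>i\<in>I. \<forall>x\<in>topspace L. p i x = p i (k x)"
    using univ[of T p] unfolding topT by blast
  \<comment> \<open>Precomposed with the identity from \<open>L\<close> to \<open>T\<close>, the map
    \<open>k\<close> becomes an endomorphism of the limit cone \<open>L\<close>. The identity is
    another one, restricted so that it is \<open>extensional\<close>, so the two agree.\<close>
  have "continuous_map L L k"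
    using continuous_map_compose[OF LT k(2)] by simp
  moreover have "continuous_map L L (restrict id (topspace L))"
    by (rule continuous_map_eq[of _ _ id]) auto
  ultimately have "k = restrict id (topspace L)"
    using k univ[of L p, OF cont comp] by (metis (no_types, lifting) id_apply restrict_apply' restrict_extensional)
  then have TL: "continuous_map T L id"
    using continuous_map_eq[OF k(2), of id] by (simp add: topT)
  have "openin L U \<longleftrightarrow> openin T U" for U
  proof
    assume "openin L U"
    moreover from this have "{x \<in> topspace T. id x \<in> U} = U"
      using openin_subset topT by fastforce
    ultimately show "openin T U" using openin_continuous_map_preimage[OF TL] by metis
  next
    assume "openin T U"
    moreover from this have "{x \<in> topspace L. id x \<in> U} = U"
      using openin_subset topT by fastforce
    ultimately show "openin L U" using openin_continuous_map_preimage[OF LT] by metis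
  qed
  then show ?thesis by (simp add: topology_eq T_def)
qed

lemma compact_opens_limit:
  fixes L :: "'x topology"
  assumes sys: "projective_system_PreSpec I r X f"
    and lim: "is_limit_Top TYPE('x) I r X f L p"
    and spec: "\<And>i. i \<in> I \<Longrightarrow> spectral_map L (X i) (p i)"
  defines "B \<equiv> (\<Union>i\<in>I. {{x \<in> topspace L. p i x \<in> V} | V. V \<in> compact_opens (X i)})"
  shows "compact_opens L = B" and "pre_spectral L"
proof -
  have dir: "\<exists>k\<in>I. (i, k) \<in> r \<and> (j, k) \<in> r" if "i \<in> I" "j \<in> I" for i j
    using sys that by (simp add: projective_system_PreSpec_def directed_poset_def)
  obtain i0 where i0: "i0 \<in> I"
    using sys by (auto simp: projective_system_PreSpec_def directed_poset_def)
  have pre: "pre_spectral (X i)" if "i \<in> I" for i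
    using sys that by (simp add: projective_system_PreSpec_def)
  have bond: "spectral_map (X i) (X j) (f i j)" if "(j, i) \<in> r" for i j
    using sys that by (simp add: projective_system_PreSpec_def)
  have cont: "\<And>i. i \<in> I \<Longrightarrow> continuous_map L (X i) (p i)"
    and comp: "compatible_maps r f L p"
    using lim by (auto simp: is_limit_Top_def)
  have BI: "{x \<in> topspace L. p i x \<in> V} \<in> B" if "i \<in> I" "V \<in> compact_opens (X i)" for i V
    using that by (auto simp: B_def)
  \<comment> \<open>The preimage of \<open>V\<close> under the bonding map from \<open>X k\<close>
    to \<open>X i\<close> is the witness: it is compact open because bonding maps are spectral, and
    compatibility of the projections equates the two preimages in \<open>L\<close>.\<close>
  have lift: "\<exists>V'\<in>compact_opens (X k). {x \<in> topspace L. p i x \<in> V} = {x \<in> topspace L. p k x \<in> V'}"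
    if "k \<in> I" "(i, k) \<in> r" "V \<in> compact_opens (X i)" for i k V
  proof
    show "{y \<in> topspace (X k). f k i y \<in> V} \<in> compact_opens (X k)"
      using bond[OF that(2)] that(3) by (simp add: spectral_map_def)
    show "{x \<in> topspace L. p i x \<in> V} =
        {x \<in> topspace L. p k x \<in> {y \<in> topspace (X k). f k i y \<in> V}}"
      using comp cont[OF that(1)] that(2)
      by (auto simp: compatible_maps_def continuous_map_def)
  qed
  \<comment> \<open>An upper bound \<open>k\<close> of the two indices presents both sets as
    preimages under the same projection \<open>p k\<close>. Unions and intersections can then be
    formed inside \<open>compact_opens (X k)\<close>.\<close>
  have common: "\<exists>k\<in>I. \<exists>V'\<in>compact_opens (X k). \<exists>W'\<in>compact_opens (X k).
      V = {x \<in> topspace L. p k x \<in> V'} \<and> W = {x \<in> topspace L. p k x \<in> W'}"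
    if "V \<in> B" "W \<in> B" for V W
  proof -
    from that obtain i j V0 W0 where *: "i \<in> I" "V0 \<in> compact_opens (X i)"
        "V = {x \<in> topspace L. p i x \<in> V0}" "j \<in> I" "W0 \<in> compact_opens (X j)"
        "W = {x \<in> topspace L. p j x \<in> W0}"
      by (auto simp: B_def)
    obtain k where k: "k \<in> I" "(i, k) \<in> r" "(j, k) \<in> r"
      using dir[OF *(1,4)] by blast
    show ?thesis
      unfolding *(3,6) using k(1) lift[OF k(1,2) *(2)] lift[OF k(1,3) *(5)] by blast
  qed
  have Un: "V \<union> W \<in> B" and Int: "V \<inter> W \<in> B" if VW: "V \<in> B" "W \<in> B" for V W
  proof -
    obtain k V' W' where k: "k \<in> I" "V' \<in> compact_opens (X k)" "W' \<in> compact_opens (X k)"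
        and eq: "V = {x \<in> topspace L. p k x \<in> V'}" "W = {x \<in> topspace L. p k x \<in> W'}"
      using common[OF VW] by blast
    have "V' \<union> W' \<in> compact_opens (X k)" "V' \<inter> W' \<in> compact_opens (X k)"
      using pre[OF k(1)] k(2,3) by (auto simp: pre_spectral_def)
    moreover have "V \<union> W = {x \<in> topspace L. p k x \<in> V' \<union> W'}"
      "V \<inter> W = {x \<in> topspace L. p k x \<in> V' \<inter> W'}"
      by (auto simp: eq)
    ultimately show "V \<union> W \<in> B" "V \<inter> W \<in> B" using BI k(1) by presburger+
  qed
  have empty: "{} \<in> B"
    using BI[OF i0, of "{}"] pre[OF i0] by (simp add: pre_spectral_def)
  have "{x \<in> topspace L. p i0 x \<in> topspace (X i0)} = topspace L"
    using cont[OF i0] by (auto simp: continuous_map_def)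
  then have top: "topspace L \<in> B"
    using BI[OF i0, of "topspace (X i0)"] pre[OF i0] by (simp add: pre_spectral_def)
  have gen: "L = topology_generated_by B"
    unfolding B_def using lim i0 pre
    by (intro is_limit_Top_generated_by) (auto simp: pre_spectral_def)
  have "B \<subseteq> compact_opens L"
    using spec by (auto simp: B_def spectral_map_def)
  then show eq: "compact_opens L = B"
    using gen empty Un Int by (intro compact_opens_generated_by_lattice)
  show "pre_spectral L"
    unfolding pre_spectral_def eq using gen empty top Un Int by blast
qed

theorem lemma7p2:
  fixes I :: "'i set" and r :: "'i rel"
    and Xs :: "'i \<Rightarrow> 'a topology" and fs :: "'i \<Rightarrow> 'i \<Rightarrow> 'a \<Rightarrow> 'a"
    and X :: "'x topology" and f :: "'i \<Rightarrow> 'x \<Rightarrow> 'a"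
  assumes "projective_system_PreSpec I r Xs fs"
    and "is_limit_Top TYPE('x) I r Xs fs X f"
    and "\<forall>i\<in>I. spectral_map X (Xs i) (f i)"
  shows "is_limit_PreSpec TYPE('y) I r Xs fs X f \<and>
         compact_opens X =
           (\<Union>i\<in>I. {{x \<in> topspace X. f i x \<in> V} | V. V \<in> compact_opens (Xs i)})"
proof -
  have eq: "compact_opens X =
      (\<Union>i\<in>I. {{x \<in> topspace X. f i x \<in> V} | V. V \<in> compact_opens (Xs i)})"
    using assms by (intro compact_opens_limit(1)) auto
  \<comment> \<open>Every compact open set of \<open>X\<close> is the preimage of a compact open
    \<open>V\<close> under some \<open>f i\<close>, so its preimage under a mediating map
    \<open>h\<close> is the preimage of \<open>V\<close> under \<open>g i\<close>, which is
    spectral.\<close>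
  have spectral: "spectral_map Y X h"
    if h: "continuous_map Y X h" and g: "\<forall>i\<in>I. spectral_map Y (Xs i) (g i)"
      and gh: "\<forall>i\<in>I. \<forall>y\<in>topspace Y. g i y = f i (h y)" for Y :: "'y topology" and g h
    unfolding spectral_map_def
  proof (intro conjI ballI h)
    fix U assume "U \<in> compact_opens X"
    then obtain i V where i: "i \<in> I" and V: "V \<in> compact_opens (Xs i)"
        and U: "U = {x \<in> topspace X. f i x \<in> V}"
      unfolding eq by blast
    have "{y \<in> topspace Y. h y \<in> U} = {y \<in> topspace Y. g i y \<in> V}"
      using h gh i by (auto simp: U continuous_map_def)
    then show "{y \<in> topspace Y. h y \<in> U} \<in> compact_opens Y"
      using g i V by (simp add: spectral_map_def)
  qed
  have "pre_spectral X"
    using assms by (intro compact_opens_limit(2)) auto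
  moreover have "compatible_maps r fs X f"
    using assms(2) by (simp add: is_limit_Top_def)
  moreover have "\<exists>!h. h \<in> extensional (topspace Y) \<and> spectral_map Y X h \<and>
      (\<forall>i\<in>I. \<forall>y\<in>topspace Y. g i y = f i (h y))"
    if g: "\<forall>i\<in>I. spectral_map Y (Xs i) (g i)" and c: "compatible_maps r fs Y g"
    for Y :: "'y topology" and g
  proof -
    have "\<forall>i\<in>I. continuous_map Y (Xs i) (g i)"
      using g by (simp add: spectral_map_def)
    \<comment> \<open>The hypothesis only tests against spaces with points of type
      \<open>'x\<close>; \<open>is_limit_Top_any_type\<close> transfers it to
      \<open>'y\<close>.\<close>
    then have "\<exists>!h. h \<in> extensional (topspace Y) \<and> continuous_map Y X h \<and>
        (\<forall>i\<in>I. \<forall>y\<in>topspace Y. g i y = f i (h y))"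
      using is_limit_Top_any_type[OF assms(2), where 'y = 'y] c
      unfolding is_limit_Top_def by blast
    \<comment> \<open>Among maps that factor the cone \<open>g\<close>, spectral and continuous mean
      the same, so existence and uniqueness both carry over from the topological limit.\<close>
    moreover have "spectral_map Y X h \<longleftrightarrow> continuous_map Y X h"
      if "\<forall>i\<in>I. \<forall>y\<in>topspace Y. g i y = f i (h y)" for h
      using spectral[OF _ g that] by (auto simp: spectral_map_def)
    ultimately show ?thesis by (metis (no_types, lifting))
  qed
  ultimately have "is_limit_PreSpec TYPE('y) I r Xs fs X f"
    unfolding is_limit_PreSpec_def using assms(3) by (intro conjI allI impI) simp_all
  with eq show ?thesis by blast
qed

end
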